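(* Let $(p_k)_{k\in\mathbb{N}}$ be a non-increasing sequence in $[0,1]$ with $\sum_k p_k=\infty$. Let $X=(X_k)_{k\in\mathbb{N}}$ be a sequence of independent Bernoulli random variables with $\mathbb{P}[X_k=1]=1-\mathbb{P}[X_k=0]=p_k$ for $k\in\mathbb{N}$, and let $\mathcal{E}_X=\{k\in\mathbb{N}:X_k=1\}$. Then for any infinite subset $S\subset\mathbb{N}$ with bounded gap, we have $$\mathbb{P}[S\cap\mathcal{E}_X\neq\emptyset]=1.$$
   Context: $\mathbb{N}=\{1,2,\dots\}$. For an infinite subset $S=\{n_1<n_2<\cdots\}\subset\mathbb{N}$, the gap of $S$ is $\mathrm{Gap}(S)=\sup_{k\in\mathbb{N}}(n_{k+1}-n_k)$, and $S$ has bounded gap if $\mathrm{Gap}(S)<\infty$. *)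

theory Defs
  imports "HOL-Probability.Probability" "HOL-Library.Infinite_Set" "HOL-Library.Extended_Nat"
begin

text \<open>
  The positive integers are rendered as the subset \<open>{1..}\<close> of \<open>nat\<close>.  The increasing enumeration
  \<open>n\<^sub>1 < n\<^sub>2 < \<dots>\<close> of an infinite set \<open>S\<close> is \<open>enumerate S\<close>, which starts at index 0; the truncated
  subtraction is harmless because the enumeration is increasing.  Only meaningful for infinite \<open>S\<close>.
\<close>

definition gap :: "nat set \<Rightarrow> enat" where
  "gap S = (SUP k. enat (enumerate S (Suc k) - enumerate S k))"

definition bounded_gap :: "nat set \<Rightarrow> bool" where
  "bounded_gap S \<longleftrightarrow> gap S < \<infinity>"

definition success_set :: "(nat \<Rightarrow> 'a \<Rightarrow> real) \<Rightarrow> 'a \<Rightarrow> nat set" where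
  "success_set X \<omega> = {k \<in> {1..}. X k \<omega> = 1}"

end

theory Submission
  imports Defs
begin

text \<open>
  Let \<open>a\<^sub>0 < a\<^sub>1 < \<dots>\<close> enumerate \<open>S\<close>, and let \<open>G\<close> bound its gaps.  Since \<open>p\<close> is non-increasing,
  the block \<open>p(a\<^sub>k) + \<dots> + p(a\<^sub>k\<^sub>+\<^sub>1 - 1)\<close> has at most \<open>G\<close> terms, none larger than \<open>p(a\<^sub>k)\<close>.  Summing over
  blocks compares the full series with \<open>G\<close> times the series along \<open>S\<close>
  (\<open>sum_le_bounded_steps\<close>), so \<open>\<Sum>\<^sub>k p(a\<^sub>k) = \<infinity>\<close> (\<open>filterlim_sum_bounded_steps\<close>).
  By independence, the first \<open>K\<close> points of \<open>S\<close> are all failures with probability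
  \<open>\<Prod>\<^sub>k\<^sub><\<^sub>K (1 - p(a\<^sub>k)) \<le> exp (- \<Sum>\<^sub>k\<^sub><\<^sub>K p(a\<^sub>k))\<close> (\<open>prob_all_failures_le\<close>), which tends to 0 with
  \<open>K\<close>.  This is the second Borel--Cantelli argument, of which only the existence of one success is
  needed.
\<close>

lemma bounded_gap_obtains:
  assumes "bounded_gap S"
  obtains G where "\<And>k. enumerate S (Suc k) - enumerate S k \<le> G"
proof -
  from assms obtain G where G: "gap S = enat G"
    unfolding bounded_gap_def by (metis less_infinityE)
  have "enat (enumerate S (Suc k) - enumerate S k) \<le> enat G" for k
    unfolding G[symmetric] gap_def by (rule SUP_upper) simp
  then show thesis
    by (intro that) simp
qed

lemma sum_le_bounded_steps:
  fixes p :: "nat \<Rightarrow> real" and a :: "nat \<Rightarrow> nat"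
  assumes nonneg: "\<And>k. k \<ge> a 0 \<Longrightarrow> 0 \<le> p k"
    and anti: "antimono_on {a 0..} p"
    and a: "mono a"
    and step: "\<And>k. a (Suc k) - a k \<le> G"
  shows "(\<Sum>j\<in>{a 0..<a K}. p j) \<le> real G * (\<Sum>k<K. p (a k))"
proof (induction K)
  case 0
  show ?case by simp
next
  case (Suc K)
  have le: "a 0 \<le> a K" "a K \<le> a (Suc K)"
    using a by (auto intro: monoD)
  have "(\<Sum>j\<in>{a K..<a (Suc K)}. p j) \<le> (\<Sum>j\<in>{a K..<a (Suc K)}. p (a K))"
    using le by (intro sum_mono) (auto intro!: monotone_onD[OF anti])
  also have "\<dots> = real (a (Suc K) - a K) * p (a K)"
    by simp
  also have "\<dots> \<le> real G * p (a K)"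
    using step[of K] nonneg[OF le(1)] by (intro mult_right_mono) auto
  finally have "(\<Sum>j\<in>{a K..<a (Suc K)}. p j) \<le> real G * p (a K)" .
  moreover have "(\<Sum>j\<in>{a 0..<a (Suc K)}. p j)
      = (\<Sum>j\<in>{a 0..<a K}. p j) + (\<Sum>j\<in>{a K..<a (Suc K)}. p j)"
    using le by (simp add: sum.atLeastLessThan_concat)
  ultimately show ?case
    using Suc.IH by (simp add: distrib_left)
qed

lemma filterlim_sum_bounded_steps:
  fixes p :: "nat \<Rightarrow> real" and a :: "nat \<Rightarrow> nat"
  assumes nonneg: "\<And>k. k \<ge> m \<Longrightarrow> 0 \<le> p k"
    and anti: "antimono_on {m..} p"
    and div: "filterlim (\<lambda>n. \<Sum>k=m..n. p k) at_top sequentially"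
    and a: "strict_mono a" "m \<le> a 0"
    and step: "\<And>k. a (Suc k) - a k \<le> G"
  shows "filterlim (\<lambda>K. \<Sum>k<K. p (a k)) at_top sequentially"
proof -
  have "a 0 < a 1"
    using a(1) by (simp add: strict_mono_less)
  then have "G > 0"
    using step[of 0] by simp
  define C where "C = (\<Sum>j\<in>{m..<a 0}. p j)"
  have block: "(\<Sum>j\<in>{a 0..<a K}. p j) \<le> real G * (\<Sum>k<K. p (a k))" for K
  proof (rule sum_le_bounded_steps)
    show "antimono_on {a 0..} p"
      using anti by (rule monotone_on_subset) (use a(2) in auto)
    show "mono a"
      using a(1) by (rule strict_mono_mono)
  qed (use nonneg a(2) step in auto)
  have lower: "((\<Sum>k=m..K. p k) - C) / real G \<le> (\<Sum>k<Suc K. p (a k))" if "K \<ge> m" for K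
  proof -
    \<comment> \<open>Strict monotonicity gives \<open>K < a (Suc K)\<close>, so the partial sum up to \<open>K\<close> is covered.\<close>
    have "Suc K \<le> a (Suc K)"
      using a(1) by (rule strict_mono_imp_increasing)
    then have "(\<Sum>k=m..K. p k) \<le> (\<Sum>k\<in>{m..<a (Suc K)}. p k)"
      using nonneg by (intro sum_mono2) auto
    also have "\<dots> = C + (\<Sum>k\<in>{a 0..<a (Suc K)}. p k)"
      unfolding C_def using a
      by (intro sum.atLeastLessThan_concat[symmetric]) (auto simp: strict_mono_less_eq)
    also have "\<dots> \<le> C + real G * (\<Sum>k<Suc K. p (a k))"
      using block[of "Suc K"] by simp
    finally show ?thesis
      using \<open>G > 0\<close> by (simp add: field_simps)
  qed
  have "filterlim (\<lambda>K. - C + (\<Sum>k=m..K. p k)) at_top sequentially"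
    by (rule filterlim_tendsto_add_at_top[OF tendsto_const div])
  then have "filterlim (\<lambda>K. (1 / real G) * (- C + (\<Sum>k=m..K. p k))) at_top sequentially"
    using \<open>G > 0\<close> by (intro filterlim_tendsto_pos_mult_at_top[OF tendsto_const]) auto
  then have "filterlim (\<lambda>K. \<Sum>k<Suc K. p (a k)) at_top sequentially"
    by (rule filterlim_at_top_mono)
       (use lower in \<open>auto simp: eventually_sequentially intro!: exI[of _ m]\<close>)
  then show ?thesis
    by (rule filterlim_sequentially_Suc[THEN iffD1])
qed

lemma (in prob_space) prob_all_failures_le:
  fixes X :: "'i \<Rightarrow> 'a \<Rightarrow> real"
  assumes indep: "indep_vars (\<lambda>_. borel) X I"
    and J: "finite J" "J \<subseteq> I"
    and p: "\<And>k. k \<in> J \<Longrightarrow> prob {\<omega> \<in> space M. X k \<omega> = 1} = p k"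
  shows "prob {\<omega> \<in> space M. \<forall>k\<in>J. X k \<omega> \<noteq> 1} \<le> exp (- (\<Sum>k\<in>J. p k))"
proof (cases "J = {}")
  case True
  then show ?thesis by simp
next
  case False
  have meas: "X k \<in> borel_measurable M" if "k \<in> J" for k
    using indep J that by (auto simp: indep_vars_def)
  have fail: "prob (X k -` (- {1}) \<inter> space M) = 1 - p k" if k: "k \<in> J" for k
  proof -
    have [measurable]: "X k \<in> borel_measurable M" by (rule meas[OF k])
    have "{\<omega> \<in> space M. X k \<omega> = 1} \<in> events" by measurable
    then have "1 - p k = prob (space M - {\<omega> \<in> space M. X k \<omega> = 1})"
      by (simp add: prob_compl p[OF k])
    also have "space M - {\<omega> \<in> space M. X k \<omega> = 1} = X k -` (- {1}) \<inter> space M"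
      by auto
    finally show ?thesis by simp
  qed
  have "{\<omega> \<in> space M. \<forall>k\<in>J. X k \<omega> \<noteq> 1} = (\<Inter>k\<in>J. X k -` (- {1}) \<inter> space M)"
    using False by auto
  then have "prob {\<omega> \<in> space M. \<forall>k\<in>J. X k \<omega> \<noteq> 1} = (\<Prod>k\<in>J. prob (X k -` (- {1}) \<inter> space M))"
    using indep_varsD[OF indep False J(1) J(2), of "\<lambda>_. - {1}"] by simp
  also have "\<dots> = (\<Prod>k\<in>J. 1 - p k)"
    by (intro prod.cong fail refl)
  also have "\<dots> \<le> (\<Prod>k\<in>J. exp (- p k))"
  proof (rule prod_mono)
    fix k assume "k \<in> J"
    then have "0 \<le> 1 - p k"
      using fail[of k] measure_nonneg[of M "X k -` (- {1}) \<inter> space M"] by simp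
    then show "0 \<le> 1 - p k \<and> 1 - p k \<le> exp (- p k)"
      using exp_ge_add_one_self[of "- p k"] by simp
  qed
  also have "\<dots> = exp (- (\<Sum>k\<in>J. p k))"
    using J(1) by (simp add: exp_sum sum_negf[symmetric])
  finally show ?thesis .
qed

theorem proposition1p3:
  fixes M :: "'a measure"
    and X :: "nat \<Rightarrow> 'a \<Rightarrow> real"
    and p :: "nat \<Rightarrow> real"
    and S :: "nat set"
  assumes "prob_space M"
    and "\<And>k. k \<ge> 1 \<Longrightarrow> p k \<in> {0..1}"
    and "antimono_on {1..} p"
    and "filterlim (\<lambda>n. \<Sum>k=1..n. p k) at_top sequentially"
    and "prob_space.indep_vars M (\<lambda>_. borel) X {1..}"
    and "\<And>k. k \<ge> 1 \<Longrightarrow> measure M {\<omega> \<in> space M. X k \<omega> = 1} = p k"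
    and "\<And>k. k \<ge> 1 \<Longrightarrow> measure M {\<omega> \<in> space M. X k \<omega> = 0} = 1 - p k"
    and "S \<subseteq> {1..}"
    and "infinite S"
    and "bounded_gap S"
  shows "measure M {\<omega> \<in> space M. S \<inter> success_set X \<omega> \<noteq> {}} = 1"
proof -
  interpret prob_space M by fact
  define a where "a = enumerate S"
  have a: "strict_mono a"
    unfolding a_def using \<open>infinite S\<close> by (rule strict_mono_enumerate)
  have a_in: "a k \<in> S" for k
    unfolding a_def using \<open>infinite S\<close> by (rule enumerate_in_set)
  obtain G where step: "\<And>k. a (Suc k) - a k \<le> G"
    unfolding a_def using bounded_gap_obtains[OF \<open>bounded_gap S\<close>] by metis
  have div: "filterlim (\<lambda>K. \<Sum>k<K. p (a k)) at_top sequentially"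
    by (rule filterlim_sum_bounded_steps[of 1, OF _ assms(3,4) a _ step])
       (use assms(2,8) a_in in auto)
  have [measurable]: "X k \<in> borel_measurable M" if "k \<in> S" for k
    using assms(5,8) that by (auto simp: indep_vars_def)
  define F where "F = {\<omega> \<in> space M. \<forall>k\<in>S. X k \<omega> \<noteq> 1}"
  have F: "F \<in> events"
    unfolding F_def by measurable
  have bound: "prob F \<le> exp (- (\<Sum>k<K. p (a k)))" for K
  proof -
    define J where "J = a ` {..<K}"
    have J: "finite J" "J \<subseteq> S"
      using a_in by (auto simp: J_def)
    have [measurable]: "X k \<in> borel_measurable M" if "k \<in> J" for k
      using that J(2) by auto
    have "prob F \<le> prob {\<omega> \<in> space M. \<forall>k\<in>J. X k \<omega> \<noteq> 1}"
    proof (rule finite_measure_mono)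
      show "F \<subseteq> {\<omega> \<in> space M. \<forall>k\<in>J. X k \<omega> \<noteq> 1}"
        using J(2) by (auto simp: F_def)
      show "{\<omega> \<in> space M. \<forall>k\<in>J. X k \<omega> \<noteq> 1} \<in> events"
        by measurable
    qed
    also have "\<dots> \<le> exp (- (\<Sum>k\<in>J. p k))"
      by (rule prob_all_failures_le[OF assms(5)]) (use J assms(6,8) in auto)
    also have "(\<Sum>k\<in>J. p k) = (\<Sum>k<K. p (a k))"
      unfolding J_def
      using a by (subst sum.reindex) (auto intro: inj_on_subset strict_mono_imp_inj_on)
    finally show ?thesis .
  qed
  have "(\<lambda>K. exp (- (\<Sum>k<K. p (a k)))) \<longlonglongrightarrow> 0"
    using div by (intro filterlim_compose[OF exp_at_bot] filterlim_compose[OF filterlim_uminus_at_bot_at_top])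
  then have "prob F \<le> 0"
    by (rule LIMSEQ_le_const) (use bound in auto)
  then have "prob (space M - F) = 1"
    using prob_compl[OF F] measure_nonneg[of M F] by simp
  also have "space M - F = {\<omega> \<in> space M. S \<inter> success_set X \<omega> \<noteq> {}}"
    using assms(8) by (auto simp: F_def success_set_def)
  finally show ?thesis .
qed

end
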